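(* Let $\mathcal X=\mathbb R^n$ or let $\mathcal X\subseteq\mathbb R^n$ be closed, bounded and convex. Let $f=(f_1,\dots,f_k)$ be continuously differentiable in an open domain containing $\mathcal X$ with Lipschitz continuous gradients $\nabla f_\ell$ on $\mathcal X$, and let $\max_{\ell=1,\dots,k} f_\ell$ be bounded from below on $\mathcal X$. Let $\{x^{(t)}\}_{t\in\mathbb N_0}$ be the iterates generated by the trust region algorithm described in the context, and assume: (i) for each $\ell$ the surrogates $m^{(t)}_\ell$ ($t\in\mathbb N_0$) belong to a fully linear class of models for $f_\ell$; (ii) the surrogates are twice continuously differentiable on an open set containing $\mathcal X$ and there is a constant $\mathrm H_{\mathrm m}>0$ with $\mathrm c\,\mathrm H_{\mathrm m}>1$ such that the Hessians satisfy $\|\nabla^2 m^{(t)}_\ell(x)\|_F\le \mathrm H_{\mathrm m}$ for all $\ell=1,\dots,k$, all $x\in B^{(t)}$ and all $t\in\mathbb N_0$; (iii) there is a constant $\kappa_{\mathrm m}\in(0,1)$ such that for all $t\in\mathbb N_0$ the step $s^{(t)}$ satisfies $x^{(t)}+s^{(t)}\in B^{(t)}$ and $$\Phi^{(t)}_{\mathrm m}(x^{(t)})-\Phi^{(t)}_{\mathrm m}(x^{(t)}+s^{(t)})\ \ge\ \kappa_{\mathrm m}\,\varpi^{(t)}_{\mathrm m}(x^{(t)})\min\left\{\frac{\varpi^{(t)}_{\mathrm m}(x^{(t)})}{\mathrm c\,\mathrm H_{\mathrm m}},\ \Delta^{(t)}\right\};$$ (iv) there is a constant $\kappa_\omega>0$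 such that $|\omega^{(t)}_{\mathrm m}(x^{(t)})-\omega(x^{(t)})|\le\kappa_\omega\,\omega^{(t)}_{\mathrm m}(x^{(t)})$ for all $t\in\mathbb N_0$. Then $\lim_{t\to\infty}\varpi(x^{(t)})=0$.
   Context: Problem: minimize $f=(f_1,\dots,f_k):\mathbb R^n\to\mathbb R^k$ over the nonempty set $\mathcal X\subseteq\mathbb R^n$. $\|\cdot\|=\|\cdot\|_\infty$, $\|\cdot\|_F$ is the Frobenius norm, $B(x;\Delta)=\{\xi\in\mathcal X:\|\xi-x\|\le\Delta\}$, and $\mathrm c>0$ is a constant with $\|x\|_2\le\sqrt{\mathrm c}\,\|x\|$ for all $x\in\mathbb R^n$. For $x\in\mathcal X$: $\omega(x)=-\min\{\max_\ell\langle\nabla f_\ell(x),d\rangle: d\in\mathcal X-x,\ \|d\|\le1\}$, $\varpi(x)=\min\{\omega(x),1\}$, $\Phi(x)=\max_\ell f_\ell(x)$. For surrogates $m^{(t)}=(m^{(t)}_1,\dots,m^{(t)}_k)$, $\omega^{(t)}_{\mathrm m},\varpi^{(t)}_{\mathrm m},\Phi^{(t)}_{\mathrm m}$ are defined in the same way with $m^{(t)}_\ell$ in place of $f_\ell$. Fully linear class: given $\Delta^{\mathrm{ub}}>0$, a set $\mathcal M\subseteq C^1(\mathbb R^n,\mathbb R)$ is a fully linear class of models for a function $g$ with Lipschitz gradient on $\mathcal X$ if (1) there are positive constants $\epsilon,\dot\epsilon,L_m$ such that for all $\Delta\in(0,\Delta^{\mathrm{ub}}]$, $x\in\mathcal X$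 there is $m\in\mathcal M$ with gradient Lipschitz with constant at most $L_m$ and with $\|\nabla g(\xi)-\nabla m(\xi)\|\le\dot\epsilon\Delta$ and $|g(\xi)-m(\xi)|\le\epsilon\Delta^2$ for all $\xi\in B(x;\Delta)$ (such $m$ is called fully linear on $B(x;\Delta)$); and (2) there is a model-improvement algorithm which in a finite number of steps, uniformly bounded in $x$ and $\Delta$, either establishes that a given $m\in\mathcal M$ is fully linear on $B(x;\Delta)$ or finds $\tilde m\in\mathcal M$ that is. The constants are assumed large enough that a model fully linear on $B(x;\Delta)$ is fully linear on $B(x;\tilde\Delta)$ for every $\tilde\Delta\in[\Delta,\Delta^{\mathrm{ub}}]$. $m^{(t)}$ is called fully linear if all its components are. Trust region algorithm. Parameters: $\varepsilon_{\mathrm{crit}}>0$, $\mu>\beta>0$, $1>\nu_{++}\ge\nu_+\ge0$ with $\nu_{++}\ne0$, $\gamma_\uparrow\ge1>\gamma_\downarrow\ge\gamma_{\downarrow\downarrow}>0$, $\alpha\in(0,1)$, $0<\Delta^{\mathrm{ub}}<\infty$; start $x^{(0)}\in\mathcal X$, $\Delta^{(0)}\in(0,\Delta^{\mathrm{ub}}]$. Write $B^{(t)}=B(x^{(t)};\Delta^{(t)})$. For $t=0,1,\dots$: 1. If $t>0$ and iteration $t-1$ was model-improving, obtain $m^{(t)}$ from $m^{(t-1)}$ by at least one step of the model-improvement algorithm; otherwise construct surrogates $m^{(t)}$ on $B^{(t)}$ (not necessarily fully linear). 2. Criticality step: if $\varpi^{(t)}_{\mathrm m}(x^{(t)})<\varepsilon_{\mathrm{crit}}$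 and ($m^{(t)}$ is not fully linear on $B^{(t)}$ or $\Delta^{(t)}>\mu\varpi^{(t)}_{\mathrm m}(x^{(t)})$), set $\Delta_*=\Delta^{(t)}$ and run the criticality routine: for $j=1,2,\dots$ set $\Delta^{(t)}:=\alpha^{j-1}\Delta_*$, make $m^{(t)}$ fully linear on $B^{(t)}$ (this may change $\varpi^{(t)}_{\mathrm m}(x^{(t)})$), and stop the loop if $\Delta^{(t)}\le\mu\varpi^{(t)}_{\mathrm m}(x^{(t)})$. Afterwards set $\Delta^{(t)}:=\min\{\max\{\Delta^{(t)},\beta\varpi^{(t)}_{\mathrm m}(x^{(t)})\},\Delta_*\}$. From here on $m^{(t)},\Delta^{(t)},B^{(t)}$ denote the values after this step. 3. Compute a step $s^{(t)}$, put $x^{(t)}_+=x^{(t)}+s^{(t)}$ and $\rho^{(t)}=\frac{\Phi(x^{(t)})-\Phi(x^{(t)}_+)}{\Phi^{(t)}_{\mathrm m}(x^{(t)})-\Phi^{(t)}_{\mathrm m}(x^{(t)}_+)}$ if $x_+^{(t)}\neq x^{(t)}$, $\rho^{(t)}=0$ otherwise. 4. Set $x^{(t+1)}=x^{(t)}_+$ if $\rho^{(t)}\ge\nu_{++}$, or if $\nu_+\le\rho^{(t)}<\nu_{++}$ and $m^{(t)}$ is fully linear; otherwise $x^{(t+1)}=x^{(t)}$. Set $\Delta^{(t+1)}=\Delta^{(t)}$ if $\rho^{(t)}<\nu_{++}$ and $m^{(t)}$ is not fully linear; choose $\Delta^{(t+1)}\in[\gamma_{\downarrow\downarrow}\Delta^{(t)},\gamma_\downarrow\Delta^{(t)}]$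 if $\rho^{(t)}<\nu_{++}$ and $m^{(t)}$ is fully linear; choose $\Delta^{(t+1)}\in[\Delta^{(t)},\min\{\gamma_\uparrow\Delta^{(t)},\Delta^{\mathrm{ub}}\}]$ if $\rho^{(t)}\ge\nu_{++}$ and $\Delta^{(t)}\ge\beta\omega^{(t)}_{\mathrm m}(x^{(t)})$; set $\Delta^{(t+1)}=\min\{\gamma_\uparrow\Delta^{(t)},\Delta^{\mathrm{ub}}\}$ if $\rho^{(t)}\ge\nu_{++}$ and $\Delta^{(t)}<\beta\omega^{(t)}_{\mathrm m}(x^{(t)})$. Iteration $t$ is successful if $\rho^{(t)}\ge\nu_{++}$; model-improving if $\rho^{(t)}<\nu_{++}$ and $m^{(t)}$ is not fully linear; acceptable if $\nu_{++}>\rho^{(t)}\ge\nu_+$ and $m^{(t)}$ is fully linear; inacceptable otherwise. If the criticality routine does not terminate in some iteration $t$, the sequences are continued by $x^{(t+j)}=x^{(t)}$, with $m^{(t+j)}$, $\Delta^{(t+j)}$ the $j$-th model and radius of the loop, and no further iteration counts as successful (hypotheses on steps then only concern iterations in which a step is computed). *)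

theory Defs
  imports "HOL-Analysis.Analysis" "HOL-Library.Extended_Nat"
begin

text \<open>
  Vectors in \<open>real^'n\<close> are measured in the maximum norm \<open>infnorm\<close>; \<open>norm\<close> on \<open>real^'n\<close> is the
  Euclidean norm.  A vector-valued map with components indexed by \<open>'k\<close> is the family of its
  components, of type \<open>'k \<Rightarrow> real^'n \<Rightarrow> real\<close>.
\<close>

section \<open>Smoothness\<close>

definition grad :: "(real^'n \<Rightarrow> real) \<Rightarrow> real^'n \<Rightarrow> real^'n" where
  "grad g x = (THE D. GDERIV g x :> D)"

definition hessian :: "(real^'n \<Rightarrow> real) \<Rightarrow> real^'n \<Rightarrow> real^'n^'n" where
  "hessian g x = matrix (frechet_derivative (grad g) (at x))"

text \<open>The type \<open>real^'n^'n\<close> carries the Frobenius norm.\<close>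

lemma norm_matrix_eq_frobenius:
  fixes A :: "real^'n^'n"
  shows "norm A = sqrt (\<Sum>i\<in>UNIV. \<Sum>j\<in>UNIV. (A $ i $ j)\<^sup>2)"
  by (simp add: norm_vec_def L2_set_def sum_nonneg)

text \<open>The next two notions are meant for open sets \<open>U\<close>.\<close>

definition C1_on :: "(real^'n) set \<Rightarrow> (real^'n \<Rightarrow> real) \<Rightarrow> bool" where
  "C1_on U g \<longleftrightarrow> (\<forall>x\<in>U. g differentiable (at x)) \<and> continuous_on U (grad g)"

definition C2_on :: "(real^'n) set \<Rightarrow> (real^'n \<Rightarrow> real) \<Rightarrow> bool" where
  "C2_on U g \<longleftrightarrow> C1_on U g \<and> (\<forall>x\<in>U. grad g differentiable (at x)) \<and> continuous_on U (hessian g)"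

text \<open>The library's \<open>lipschitz_on\<close> refers to the Euclidean distance.\<close>

definition infnorm_lipschitz_on :: "real \<Rightarrow> (real^'n) set \<Rightarrow> (real^'n \<Rightarrow> real^'n) \<Rightarrow> bool" where
  "infnorm_lipschitz_on L X F \<longleftrightarrow>
     0 \<le> L \<and> (\<forall>x\<in>X. \<forall>y\<in>X. infnorm (F x - F y) \<le> L * infnorm (x - y))"


section \<open>Criticality measures\<close>

definition tr_ball :: "(real^'n) set \<Rightarrow> real^'n \<Rightarrow> real \<Rightarrow> (real^'n) set" where
  "tr_ball X x \<Delta> = {\<xi> \<in> X. infnorm (\<xi> - x) \<le> \<Delta>}"

text \<open>
  For closed \<open>X\<close> and \<open>x \<in> X\<close> the infimum is over a nonempty compact set, hence a minimum.
\<close>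

definition omega :: "(real^'n) set \<Rightarrow> ('k::finite \<Rightarrow> real^'n \<Rightarrow> real) \<Rightarrow> real^'n \<Rightarrow> real" where
  "omega X F x =
     - (INF d \<in> {d. x + d \<in> X \<and> infnorm d \<le> 1}. MAX l. grad (F l) x \<bullet> d)"

definition varpi :: "(real^'n) set \<Rightarrow> ('k::finite \<Rightarrow> real^'n \<Rightarrow> real) \<Rightarrow> real^'n \<Rightarrow> real" where
  "varpi X F x = min (omega X F x) 1"

definition Phi :: "('k::finite \<Rightarrow> real^'n \<Rightarrow> real) \<Rightarrow> real^'n \<Rightarrow> real" where
  "Phi F x = (MAX l. F l x)"


section \<open>Fully linear classes\<close>

text \<open>
  \<open>improve C x \<Delta> m m'\<close> means that \<open>m'\<close> is a possible result of performing one step of the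
  model-improvement algorithm on the model \<open>m\<close> for the trust region with center \<open>x\<close> and
  radius \<open>\<Delta>\<close>.
\<close>

record ('n::finite) model_class =
  models :: "(real^'n \<Rightarrow> real) set"
  eps_val :: real
  eps_grad :: real
  lip_grad :: real
  improve :: "real^'n \<Rightarrow> real \<Rightarrow> (real^'n \<Rightarrow> real) \<Rightarrow> (real^'n \<Rightarrow> real) \<Rightarrow> bool"

definition fully_linear ::
  "(real^'n) set \<Rightarrow> 'n model_class \<Rightarrow> (real^'n \<Rightarrow> real) \<Rightarrow> real^'n \<Rightarrow> real
    \<Rightarrow> (real^'n \<Rightarrow> real) \<Rightarrow> bool" where
  "fully_linear X C g x \<Delta> m \<longleftrightarrow>
     m \<in> models C \<and> infnorm_lipschitz_on (lip_grad C) X (grad m) \<and>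
     (\<forall>\<xi>\<in>tr_ball X x \<Delta>.
        infnorm (grad g \<xi> - grad m \<xi>) \<le> eps_grad C * \<Delta> \<and>
        \<bar>g \<xi> - m \<xi>\<bar> \<le> eps_val C * \<Delta>\<^sup>2)"

text \<open>
  The algorithm may be nondeterministic, so the bound \<open>N\<close> on the number of steps is required of
  every run.  On a fully linear model the algorithm only establishes this fact and returns the
  model unchanged; hence being fully linear after exactly \<open>N\<close> steps is the same as having become
  so after at most \<open>N\<close> steps.
\<close>

definition model_improvement ::
  "(real^'n) set \<Rightarrow> real \<Rightarrow> 'n model_class \<Rightarrow> (real^'n \<Rightarrow> real) \<Rightarrow> bool" where
  "model_improvement X \<Delta>ub C g \<longleftrightarrow>
     (\<forall>x\<in>X. \<forall>\<Delta>\<in>{0<..\<Delta>ub}. \<forall>m\<in>models C.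
        (\<exists>m'. improve C x \<Delta> m m') \<and>
        (\<forall>m'. improve C x \<Delta> m m' \<longrightarrow>
           m' \<in> models C \<and> (fully_linear X C g x \<Delta> m \<longrightarrow> m' = m))) \<and>
     (\<exists>N. \<forall>x\<in>X. \<forall>\<Delta>\<in>{0<..\<Delta>ub}. \<forall>M :: nat \<Rightarrow> real^'n \<Rightarrow> real.
        M 0 \<in> models C \<and> (\<forall>i<N. improve C x \<Delta> (M i) (M (Suc i))) \<longrightarrow>
        fully_linear X C g x \<Delta> (M N))"

text \<open>
  The last conjunct says that the constants are large enough for full linearity to be inherited
  by larger trust regions.
\<close>

definition fully_linear_class ::
  "(real^'n) set \<Rightarrow> real \<Rightarrow> 'n model_class \<Rightarrow> (real^'n \<Rightarrow> real) \<Rightarrow> bool" where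
  "fully_linear_class X \<Delta>ub C g \<longleftrightarrow>
     (\<forall>m\<in>models C. C1_on UNIV m) \<and>
     0 < eps_val C \<and> 0 < eps_grad C \<and> 0 < lip_grad C \<and>
     (\<forall>\<Delta>\<in>{0<..\<Delta>ub}. \<forall>x\<in>X. \<exists>m. fully_linear X C g x \<Delta> m) \<and>
     model_improvement X \<Delta>ub C g \<and>
     (\<forall>x\<in>X. \<forall>\<Delta>\<in>{0<..\<Delta>ub}. \<forall>\<Delta>'\<in>{\<Delta>..\<Delta>ub}. \<forall>m.
        fully_linear X C g x \<Delta> m \<longrightarrow> fully_linear X C g x \<Delta>' m)"

definition fully_linear_all ::
  "(real^'n) set \<Rightarrow> ('k::finite \<Rightarrow> 'n model_class) \<Rightarrow> ('k \<Rightarrow> real^'n \<Rightarrow> real) \<Rightarrow> real^'n \<Rightarrow> real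
    \<Rightarrow> ('k \<Rightarrow> real^'n \<Rightarrow> real) \<Rightarrow> bool" where
  "fully_linear_all X C f x \<Delta> m \<longleftrightarrow> (\<forall>l. fully_linear X (C l) (f l) x \<Delta> (m l))"


section \<open>The trust region algorithm\<close>

record tr_params =
  eps_crit :: real
  mu :: real
  beta :: real
  nu_pp :: real
  nu_p :: real
  gamma_up :: real
  gamma_down :: real
  gamma_ddown :: real
  alpha :: real
  Delta_ub :: real

definition valid_params :: "tr_params \<Rightarrow> bool" where
  "valid_params P \<longleftrightarrow>
     0 < eps_crit P \<and> 0 < beta P \<and> beta P < mu P \<and>
     0 \<le> nu_p P \<and> nu_p P \<le> nu_pp P \<and> nu_pp P < 1 \<and> nu_pp P \<noteq> 0 \<and>
     0 < gamma_ddown P \<and> gamma_ddown P \<le> gamma_down P \<and> gamma_down P < 1 \<and> 1 \<le> gamma_up P \<and>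
     0 < alpha P \<and> alpha P < 1 \<and> 0 < Delta_ub P"

definition crit_entered ::
  "tr_params \<Rightarrow> (real^'n) set \<Rightarrow> ('k::finite \<Rightarrow> 'n model_class) \<Rightarrow> ('k \<Rightarrow> real^'n \<Rightarrow> real)
    \<Rightarrow> real^'n \<Rightarrow> real \<Rightarrow> ('k \<Rightarrow> real^'n \<Rightarrow> real) \<Rightarrow> bool" where
  "crit_entered P X C f x \<Delta> m \<longleftrightarrow>
     varpi X m x < eps_crit P \<and>
     (\<not> fully_linear_all X C f x \<Delta> m \<or> \<Delta> > mu P * varpi X m x)"

text \<open>
  The routine, called with radius \<open>\<Delta>s\<close>, performs \<open>J\<close> loops with models \<open>r 1, \<dots>, r J\<close> and
  returns the model \<open>m\<close> and the radius \<open>\<Delta>\<close>.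
\<close>

definition crit_result ::
  "tr_params \<Rightarrow> (real^'n) set \<Rightarrow> ('k::finite \<Rightarrow> 'n model_class) \<Rightarrow> ('k \<Rightarrow> real^'n \<Rightarrow> real)
    \<Rightarrow> real^'n \<Rightarrow> real \<Rightarrow> ('k \<Rightarrow> real^'n \<Rightarrow> real) \<Rightarrow> real \<Rightarrow> bool" where
  "crit_result P X C f x \<Delta>s m \<Delta> \<longleftrightarrow>
     (\<exists>J\<ge>1. \<exists>r :: nat \<Rightarrow> 'k \<Rightarrow> real^'n \<Rightarrow> real.
        (\<forall>j\<in>{1..J}. fully_linear_all X C f x (alpha P ^ (j - 1) * \<Delta>s) (r j)) \<and>
        (\<forall>j\<in>{1..<J}. \<not> alpha P ^ (j - 1) * \<Delta>s \<le> mu P * varpi X (r j) x) \<and>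
        alpha P ^ (J - 1) * \<Delta>s \<le> mu P * varpi X (r J) x \<and>
        m = r J \<and>
        \<Delta> = min (max (alpha P ^ (J - 1) * \<Delta>s) (beta P * varpi X m x)) \<Delta>s)"

definition rho ::
  "('k::finite \<Rightarrow> real^'n \<Rightarrow> real) \<Rightarrow> ('k \<Rightarrow> real^'n \<Rightarrow> real) \<Rightarrow> real^'n \<Rightarrow> real^'n \<Rightarrow> real" where
  "rho f m x s =
     (if x + s \<noteq> x then (Phi f x - Phi f (x + s)) / (Phi m x - Phi m (x + s)) else 0)"

definition model_improving ::
  "tr_params \<Rightarrow> (real^'n) set \<Rightarrow> ('k::finite \<Rightarrow> 'n model_class) \<Rightarrow> ('k \<Rightarrow> real^'n \<Rightarrow> real)
    \<Rightarrow> real^'n \<Rightarrow> ('k \<Rightarrow> real^'n \<Rightarrow> real) \<Rightarrow> real \<Rightarrow> real^'n \<Rightarrow> bool" where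
  "model_improving P X C f x m \<Delta> s \<longleftrightarrow>
     rho f m x s < nu_pp P \<and> \<not> fully_linear_all X C f x \<Delta> m"

text \<open>
  The update at the end of an iteration: \<open>x'\<close> is the next iterate, \<open>\<Delta>'\<close> the next radius.
\<close>

definition tr_update ::
  "tr_params \<Rightarrow> (real^'n) set \<Rightarrow> ('k::finite \<Rightarrow> 'n model_class) \<Rightarrow> ('k \<Rightarrow> real^'n \<Rightarrow> real)
    \<Rightarrow> real^'n \<Rightarrow> ('k \<Rightarrow> real^'n \<Rightarrow> real) \<Rightarrow> real \<Rightarrow> real^'n \<Rightarrow> real^'n \<Rightarrow> real \<Rightarrow> bool" where
  "tr_update P X C f x m \<Delta> s x' \<Delta>' \<longleftrightarrow>
     x' = (if rho f m x s \<ge> nu_pp P \<or>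
              nu_p P \<le> rho f m x s \<and> rho f m x s < nu_pp P \<and> fully_linear_all X C f x \<Delta> m
           then x + s else x) \<and>
     (if rho f m x s < nu_pp P
      then (if fully_linear_all X C f x \<Delta> m
            then \<Delta>' \<in> {gamma_ddown P * \<Delta>..gamma_down P * \<Delta>}
            else \<Delta>' = \<Delta>)
      else (if \<Delta> \<ge> beta P * omega X m x
            then \<Delta>' \<in> {\<Delta>..min (gamma_up P * \<Delta>) (Delta_ub P)}
            else \<Delta>' = min (gamma_up P * \<Delta>) (Delta_ub P)))"

text \<open>
  \<open>tr_run P X C f x m\<^sub>0 \<Delta>\<^sub>0 m \<Delta> s T\<close>: the sequences form a run of the algorithm, where in
  iteration \<open>t\<close> the model and radius are \<open>m\<^sub>0 t\<close> and \<open>\<Delta>\<^sub>0 t\<close> before the criticality step and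
  \<open>m t\<close> and \<open>\<Delta> t\<close> after it, and \<open>s t\<close> is the step.  If all criticality routines terminate then
  \<open>T = \<infinity>\<close>; otherwise \<open>T\<close> is the iteration whose routine runs forever.  A step is computed in
  exactly the iterations \<open>t < T\<close>.  In the nonterminating case \<open>m T\<close> and \<open>\<Delta> T\<close> are the values on
  entry of the routine and the later entries are those of its loops.  Surrogates constructed
  afresh are not restricted here, and neither is the computation of the steps.
\<close>

definition tr_run ::
  "tr_params \<Rightarrow> (real^'n) set \<Rightarrow> ('k::finite \<Rightarrow> 'n model_class) \<Rightarrow> ('k \<Rightarrow> real^'n \<Rightarrow> real)
    \<Rightarrow> (nat \<Rightarrow> real^'n) \<Rightarrow> (nat \<Rightarrow> 'k \<Rightarrow> real^'n \<Rightarrow> real) \<Rightarrow> (nat \<Rightarrow> real)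
    \<Rightarrow> (nat \<Rightarrow> 'k \<Rightarrow> real^'n \<Rightarrow> real) \<Rightarrow> (nat \<Rightarrow> real) \<Rightarrow> (nat \<Rightarrow> real^'n) \<Rightarrow> enat \<Rightarrow> bool" where
  "tr_run P X C f x m\<^sub>0 \<Delta>\<^sub>0 m \<Delta> s T \<longleftrightarrow>
     x 0 \<in> X \<and> 0 < \<Delta>\<^sub>0 0 \<and> \<Delta>\<^sub>0 0 \<le> Delta_ub P \<and>
     (\<forall>t. enat (Suc t) \<le> T \<and> model_improving P X C f (x t) (m t) (\<Delta> t) (s t) \<longrightarrow>
        (\<forall>l. tranclp (improve (C l) (x (Suc t)) (\<Delta>\<^sub>0 (Suc t))) (m t l) (m\<^sub>0 (Suc t) l))) \<and>
     (\<forall>t. enat t < T \<longrightarrow>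
        (if crit_entered P X C f (x t) (\<Delta>\<^sub>0 t) (m\<^sub>0 t)
         then crit_result P X C f (x t) (\<Delta>\<^sub>0 t) (m t) (\<Delta> t)
         else m t = m\<^sub>0 t \<and> \<Delta> t = \<Delta>\<^sub>0 t) \<and>
        tr_update P X C f (x t) (m t) (\<Delta> t) (s t) (x (Suc t)) (\<Delta>\<^sub>0 (Suc t))) \<and>
     (\<forall>t. enat t = T \<longrightarrow>
        crit_entered P X C f (x t) (\<Delta>\<^sub>0 t) (m\<^sub>0 t) \<and> m t = m\<^sub>0 t \<and> \<Delta> t = \<Delta>\<^sub>0 t \<and>
        (\<forall>j\<ge>1. x (t + j) = x t \<and> \<Delta> (t + j) = alpha P ^ (j - 1) * \<Delta>\<^sub>0 t \<and>
           fully_linear_all X C f (x t) (\<Delta> (t + j)) (m (t + j)) \<and>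
           \<not> \<Delta> (t + j) \<le> mu P * varpi X (m (t + j)) (x t)))"

end

theory Submission
  imports Defs
begin

text \<open>
  After the criticality step the model criticality \<open>\<varpi>\<^sub>m\<close> is bounded below in terms of the radius,
  so every successful iteration with a radius bounded away from zero decreases \<open>\<Phi>\<close> by a fixed
  amount; since \<open>\<Phi>\<close> is bounded below, the radii tend to zero.  A fully linear model with radius small
  compared to \<open>\<varpi>\<^sub>m\<close> gives a successful iteration, so the radii would stay bounded away from zero if
  \<open>\<varpi>\<close> did, and hence \<open>\<varpi>\<close> becomes arbitrarily small infinitely often.  If \<open>\<varpi>\<close> were also
  at least some \<open>r > 0\<close> infinitely often, then between such an iterate and the next one below \<open>r / 2\<close> the
  path length is bounded by the decrease of \<open>\<Phi>\<close>, which tends to zero; this contradicts the Lipschitz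
  continuity of \<open>\<omega>\<close>.  In the nonterminating criticality routine \<open>\<varpi>\<^sub>m\<close> is dominated by the
  geometrically decreasing radii.
\<close>

section \<open>Lipschitz continuity of the criticality measure\<close>

lemma le_Max_range: "a l \<le> (MAX l. a l)" for a :: "'k::finite \<Rightarrow> real"
  by simp

lemma Max_range_le_add:
  fixes a b :: "'k::finite \<Rightarrow> real"
  assumes "\<And>l. a l \<le> b l + e"
  shows "(MAX l. a l) \<le> (MAX l. b l) + e"
proof -
  have "a l \<le> (MAX l. b l) + e" for l
    using assms[of l] le_Max_range[of b l] by linarith
  then show ?thesis by simp
qed

lemma abs_inner_le_infnorm:
  fixes a d :: "'a::euclidean_space"
  shows "\<bar>a \<bullet> d\<bar> \<le> real DIM('a) * infnorm a * infnorm d"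
proof -
  have "\<bar>a \<bullet> d\<bar> \<le> norm a * norm d"
    by (rule Cauchy_Schwarz_ineq2)
  also have "\<dots> \<le> (sqrt DIM('a) * infnorm a) * (sqrt DIM('a) * infnorm d)"
    by (intro mult_mono norm_le_infnorm) (auto simp: infnorm_pos_le)
  also have "\<dots> = real DIM('a) * infnorm a * infnorm d"
    by (simp add: algebra_simps)
  finally show ?thesis .
qed

text \<open>The real infimum is a lower bound only if the values are bounded below; Cauchy-Schwarz
  on the unit ball supplies this without exhibiting a minimizer.\<close>

lemma minus_omega_le:
  assumes "x + d \<in> X" "infnorm d \<le> 1"
  shows "- omega X F x \<le> (MAX l. grad (F l) x \<bullet> d)"
proof -
  define A where "A = {d. x + d \<in> X \<and> infnorm d \<le> 1}"
  \<comment> \<open>One arbitrary component suffices, because the maximum dominates it.\<close>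
  fix l
  have "- (real DIM(real^'a) * infnorm (grad (F l) x)) \<le> (MAX l. grad (F l) x \<bullet> e)"
    if "e \<in> A" for e
  proof -
    have "\<bar>grad (F l) x \<bullet> e\<bar> \<le> real DIM(real^'a) * infnorm (grad (F l) x) * infnorm e"
      by (rule abs_inner_le_infnorm)
    also have "\<dots> \<le> real DIM(real^'a) * infnorm (grad (F l) x)"
      using that unfolding A_def by (intro mult_left_le) (auto simp: infnorm_pos_le)
    finally show ?thesis
      using le_Max_range[of "\<lambda>l. grad (F l) x \<bullet> e" l] by linarith
  qed
  then have "bdd_below ((\<lambda>d. MAX l. grad (F l) x \<bullet> d) ` A)"
    by (rule bdd_belowI2)
  with assms show ?thesis
    unfolding omega_def A_def by (auto intro: cINF_lower)
qed

lemma omega_nonneg: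
  assumes "x \<in> X"
  shows "0 \<le> omega X F x"
  using minus_omega_le[of x 0 X F] assms by (simp add: infnorm_0)

lemma varpi_nonneg: "x \<in> X \<Longrightarrow> 0 \<le> varpi X F x"
  by (simp add: varpi_def omega_nonneg)

text \<open>Every direction \<open>d\<close> feasible at \<open>x\<close> is traded for some
  \<open>d'\<close> feasible at \<open>y\<close>, and only then is the infimum taken. The cost
  splits into the change of the gradients, \<open>b\<close>, and that of the direction,
  \<open>e\<close>.\<close>

lemma omega_diff_le:
  fixes x y :: "real^'n"
  assumes "x \<in> X"
    and grad: "\<And>l. infnorm (grad (F l) y - grad (F l) x) \<le> b"
    and feasible: "\<And>d. x + d \<in> X \<Longrightarrow> infnorm d \<le> 1 \<Longrightarrow>
      \<exists>d'. y + d' \<in> X \<and> infnorm d' \<le> 1 \<and> (\<forall>l. grad (F l) y \<bullet> (d' - d) \<le> e)"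
  shows "omega X F x - omega X F y \<le> real DIM(real^'n) * b + e"
proof -
  have "- omega X F y - (real DIM(real^'n) * b + e) \<le> (MAX l. grad (F l) x \<bullet> d)"
    if d: "x + d \<in> X" "infnorm d \<le> 1" for d
  proof -
    obtain d' where d': "y + d' \<in> X" "infnorm d' \<le> 1" "\<And>l. grad (F l) y \<bullet> (d' - d) \<le> e"
      using feasible[OF d] by blast
    have "grad (F l) y \<bullet> d' \<le> grad (F l) x \<bullet> d + (real DIM(real^'n) * b + e)" for l
    proof -
      have "(grad (F l) y - grad (F l) x) \<bullet> d
          \<le> real DIM(real^'n) * infnorm (grad (F l) y - grad (F l) x) * infnorm d"
        using abs_inner_le_infnorm abs_le_D1 by blast
      also have "\<dots> \<le> real DIM(real^'n) * b * 1"
        using grad[of l] d(2) order_trans[OF infnorm_pos_le grad[of l]]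
        by (intro mult_mono) (auto simp: infnorm_pos_le)
      finally show ?thesis
        using d'(3)[of l] by (simp add: inner_diff_left inner_diff_right)
    qed
    then have "(MAX l. grad (F l) y \<bullet> d')
        \<le> (MAX l. grad (F l) x \<bullet> d) + (real DIM(real^'n) * b + e)"
      by (rule Max_range_le_add)
    with minus_omega_le[OF d'(1,2), of F] show ?thesis by linarith
  qed
  moreover have "0 \<in> {d. x + d \<in> X \<and> infnorm d \<le> 1}"
    using \<open>x \<in> X\<close> by (simp add: infnorm_0)
  ultimately have "- omega X F y - (real DIM(real^'n) * b + e)
      \<le> (INF d \<in> {d. x + d \<in> X \<and> infnorm d \<le> 1}. MAX l. grad (F l) x \<bullet> d)"
    by (intro cINF_greatest) blast+
  then show ?thesis by (simp add: omega_def)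
qed

text \<open>Contracting \<open>x + d\<close> towards \<open>y\<close> makes the direction feasible at \<open>y\<close>.\<close>

lemma convex_feasible_direction:
  fixes x y d :: "'a::euclidean_space"
  assumes "convex X" "y \<in> X" "x + d \<in> X" "infnorm d \<le> 1"
  obtains d' where "y + d' \<in> X" "infnorm d' \<le> 1" "infnorm (d' - d) \<le> 2 * infnorm (x - y)"
proof
  define q where "q = infnorm (x - y)"
  \<comment> \<open>The vector \<open>x + d - y\<close> has norm at most \<open>1 + q\<close>, so
    this factor brings it into the unit ball.\<close>
  define u where "u = 1 / (1 + q)"
  define d' where "d' = u *\<^sub>R (x + d - y)"
  have q: "0 \<le> q" by (simp add: q_def infnorm_pos_le)
  then have u: "0 \<le> u" "u \<le> 1" "u * (1 + q) = 1" "1 - u \<le> q"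
    by (auto simp: u_def field_simps)
  have "(1 - u) *\<^sub>R y + u *\<^sub>R (x + d) \<in> X"
    using assms u by (intro convexD) auto
  then show "y + d' \<in> X" by (simp add: d'_def algebra_simps)
  have "infnorm (x + d - y) \<le> 1 + q"
    using infnorm_triangle[of "x - y" d] assms(4) by (simp add: q_def algebra_simps)
  then have "u * infnorm (x + d - y) \<le> u * (1 + q)"
    by (rule mult_left_mono) (rule u)
  then show "infnorm d' \<le> 1"
    using u by (simp add: d'_def infnorm_mul)
  have "d' - d = u *\<^sub>R (x - y) + (- (1 - u)) *\<^sub>R d"
    by (simp add: d'_def algebra_simps)
  then have "infnorm (d' - d) \<le> u * q + (1 - u) * infnorm d"
    using infnorm_triangle[of "u *\<^sub>R (x - y)" "(- (1 - u)) *\<^sub>R d"] u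
    by (simp add: infnorm_mul q_def)
  also have "\<dots> \<le> 1 * q + q * 1"
    using u q assms(4) by (intro add_mono mult_mono) (auto simp: infnorm_pos_le)
  finally show "infnorm (d' - d) \<le> 2 * infnorm (x - y)" by (simp add: q_def)
qed

lemma omega_lipschitz:
  fixes X :: "(real^'n) set" and F :: "'k::finite \<Rightarrow> real^'n \<Rightarrow> real"
  assumes X: "X = UNIV \<or> bounded X \<and> convex X"
    and lip: "\<And>l. \<exists>L. infnorm_lipschitz_on L X (grad (F l))"
  obtains K where "0 \<le> K"
    "\<And>x y. x \<in> X \<Longrightarrow> y \<in> X \<Longrightarrow> \<bar>omega X F x - omega X F y\<bar> \<le> K * infnorm (x - y)"
proof -
  let ?N = "real DIM(real^'n)"
  obtain L' where L': "\<And>l. infnorm_lipschitz_on (L' l) X (grad (F l))"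
    using lip by metis
  define L where "L = (\<Sum>l\<in>UNIV. L' l)"
  have L'0: "0 \<le> L' l" for l
    using L'[of l] by (simp add: infnorm_lipschitz_on_def)
  then have L0: "0 \<le> L" by (simp add: L_def sum_nonneg)
  have L: "infnorm (grad (F l) x - grad (F l) y) \<le> L * infnorm (x - y)"
    if "x \<in> X" "y \<in> X" for l x y
  proof -
    have "L' l \<le> L"
      unfolding L_def using L'0 by (intro member_le_sum) auto
    then have "L' l * infnorm (x - y) \<le> L * infnorm (x - y)"
      by (intro mult_right_mono) (auto simp: infnorm_pos_le)
    with L'[of l] that show ?thesis
      by (fastforce simp: infnorm_lipschitz_on_def)
  qed
  \<comment> \<open>\<open>G\<close> bounds the cost of transporting a direction from
    \<open>x\<close> to \<open>y\<close> per unit of distance.\<close>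
  obtain G where G0: "0 \<le> G" and feas: "\<And>x y d. \<lbrakk>x \<in> X; y \<in> X; x + d \<in> X; infnorm d \<le> 1\<rbrakk> \<Longrightarrow>
    \<exists>d'. y + d' \<in> X \<and> infnorm d' \<le> 1 \<and> (\<forall>l. grad (F l) y \<bullet> (d' - d) \<le> G * infnorm (x - y))"
  proof (cases "X = UNIV")
    case True
    \<comment> \<open>On the whole space every direction stays feasible, so \<open>G = 0\<close>
      works even for unbounded gradients.\<close>
    then show ?thesis
      by (intro that[of 0]) (auto intro!: exI[of _ d for d])
  next
    case False
    with X have "bounded X" "convex X" by auto
    have "\<exists>M. 0 \<le> M \<and> (\<forall>y\<in>X. \<forall>l. infnorm (grad (F l) y) \<le> M)"
    proof (cases "X = {}")
      case nonempty: False
      then obtain x0 where x0: "x0 \<in> X" by blast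
      obtain r where r: "\<And>y. y \<in> X \<Longrightarrow> norm y \<le> r"
        using \<open>bounded X\<close> by (auto simp: bounded_iff)
      \<comment> \<open>Gradient size at a reference point plus the growth that the Lipschitz bound
        allows over a set of diameter at most \<open>2 * r\<close>.\<close>
      define M where "M = (\<Sum>l\<in>UNIV. infnorm (grad (F l) x0)) + L * (2 * r)"
      have r0: "0 \<le> r" using r[OF x0] norm_ge_zero order_trans by blast
      have "infnorm (grad (F l) y) \<le> M" if "y \<in> X" for y l
      proof -
        have "infnorm (grad (F l) y) \<le> infnorm (grad (F l) x0) + infnorm (grad (F l) y - grad (F l) x0)"
          using infnorm_triangle[of "grad (F l) x0" "grad (F l) y - grad (F l) x0"] by simp
        moreover have "infnorm (grad (F l) y - grad (F l) x0) \<le> L * infnorm (y - x0)"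
          using L x0 that by blast
        moreover have "L * infnorm (y - x0) \<le> L * (2 * r)"
        proof (intro mult_left_mono L0)
          show "infnorm (y - x0) \<le> 2 * r"
            using infnorm_le_norm[of "y - x0"] norm_triangle_ineq4[of y x0] r[OF that] r[OF x0]
            by linarith
        qed
        moreover have "infnorm (grad (F l) x0) \<le> (\<Sum>l\<in>UNIV. infnorm (grad (F l) x0))"
          by (intro member_le_sum) (auto simp: infnorm_pos_le)
        ultimately show ?thesis by (simp add: M_def)
      qed
      moreover have "0 \<le> M"
        using L0 r0 by (simp add: M_def sum_nonneg infnorm_pos_le)
      ultimately show ?thesis by blast
    qed auto
    then obtain M where M: "0 \<le> M" "\<And>y l. y \<in> X \<Longrightarrow> infnorm (grad (F l) y) \<le> M"
      by blast
    show ?thesis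
    proof (rule that)
      show "0 \<le> ?N * M * 2" using M by simp
    next
      fix x y d assume *: "x \<in> X" "y \<in> X" "x + d \<in> X" "infnorm d \<le> 1"
      obtain d' where d': "y + d' \<in> X" "infnorm d' \<le> 1" "infnorm (d' - d) \<le> 2 * infnorm (x - y)"
        using convex_feasible_direction[OF \<open>convex X\<close> *(2-4)] .
      have "grad (F l) y \<bullet> (d' - d) \<le> ?N * M * 2 * infnorm (x - y)" for l
      proof -
        have "grad (F l) y \<bullet> (d' - d) \<le> ?N * infnorm (grad (F l) y) * infnorm (d' - d)"
          using abs_inner_le_infnorm abs_le_D1 by blast
        also have "\<dots> \<le> ?N * M * (2 * infnorm (x - y))"
          using M *(2) d'(3) by (intro mult_mono) (auto simp: infnorm_pos_le)
        finally show ?thesis by (simp add: mult.assoc)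
      qed
      with d' show "\<exists>d'. y + d' \<in> X \<and> infnorm d' \<le> 1 \<and>
          (\<forall>l. grad (F l) y \<bullet> (d' - d) \<le> ?N * M * 2 * infnorm (x - y))"
        by blast
    qed
  qed
  have le: "omega X F x - omega X F y \<le> (?N * L + G) * infnorm (x - y)"
    if "x \<in> X" "y \<in> X" for x y
  proof -
    have "infnorm (grad (F l) y - grad (F l) x) \<le> L * infnorm (x - y)" for l
      using L[OF that(2,1)] by (simp add: infnorm_sub)
    then have "omega X F x - omega X F y \<le> ?N * (L * infnorm (x - y)) + G * infnorm (x - y)"
      using feas that by (intro omega_diff_le) blast+
    then show ?thesis by (simp add: algebra_simps)
  qed
  show ?thesis
  proof (rule that)
    show "0 \<le> ?N * L + G" using L0 G0 by simp
    show "\<bar>omega X F x - omega X F y\<bar> \<le> (?N * L + G) * infnorm (x - y)"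
      if "x \<in> X" "y \<in> X" for x y
      using le[OF that] le[OF that(2,1)] by (simp add: infnorm_sub abs_le_iff)
  qed
qed

section \<open>Real sequences generated by a trust region method\<close>

text \<open>What the limit argument sees of the algorithm: objective values \<open>\<phi>\<close>,
  true and model criticality \<open>w\<close> and \<open>v\<close>, radii \<open>D\<^sub>0\<close>
  and \<open>D\<close> before and after the criticality step, and predicates \<open>S\<close> for
  success and \<open>F\<close> for full linearity. The constants \<open>\<eta>\<close> and
  \<open>h\<close> come from sufficient decrease; \<open>b\<close> is the ratio of radius to
  \<open>v\<close> up to which a fully linear model ensures success.\<close>

locale trust_region_sequences =
  fixes x :: "nat \<Rightarrow> 'a::euclidean_space"
    and \<phi> w v D D\<^sub>0 :: "nat \<Rightarrow> real"
    and S F :: "nat \<Rightarrow> bool"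
    and \<eta> h b ec \<mu> \<beta> gd g gu K \<kappa> \<phi>min :: real
  assumes pos: "0 < \<eta>" "0 < h" "0 < b" "0 < ec" "0 < \<mu>" "0 < \<beta>" "0 < gd" "g < 1"
      "1 \<le> gu" "0 \<le> K" "0 < \<kappa>"
    and w_nonneg: "0 \<le> w t"
    and D_pos: "0 < D t" and D_le: "D t \<le> D\<^sub>0 t"
    and crit: "ec \<le> v t \<or> D t \<le> \<mu> * v t"
    and D_ge: "min (\<beta> * v t) (D\<^sub>0 t) \<le> D t"
    and w_le: "w t \<le> \<kappa> * v t"
    and decrease: "S t \<Longrightarrow> \<eta> * v t * min (v t / h) (D t) \<le> \<phi> t - \<phi> (Suc t)"
    and mono: "\<phi> (Suc t) \<le> \<phi> t"
    and bounded: "\<phi>min \<le> \<phi> t"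
    and success: "F t \<Longrightarrow> D t \<le> b * v t \<Longrightarrow> S t"
    and radius_S: "S t \<Longrightarrow> D\<^sub>0 (Suc t) \<in> {D t..gu * D t}"
    and radius_F: "\<not> S t \<Longrightarrow> F t \<Longrightarrow> D\<^sub>0 (Suc t) \<in> {gd * D t..g * D t}"
    and radius_N: "\<not> S t \<Longrightarrow> \<not> F t \<Longrightarrow> D\<^sub>0 (Suc t) = D t"
    and iterate_N: "\<not> S t \<Longrightarrow> \<not> F t \<Longrightarrow> x (Suc t) = x t"
    and iterate: "infnorm (x (Suc t) - x t) \<le> D t"
    and inf_often: "\<exists>t\<ge>n. S t \<or> F t"
    and w_lipschitz: "\<bar>w s - w t\<bar> \<le> K * infnorm (x s - x t)"
begin

section \<open>Convergence of the radii to zero\<close>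

lemma \<phi>_convergent:
  obtains L where "\<phi> \<longlonglongrightarrow> L" "\<And>t. L \<le> \<phi> t"
proof -
  have "decseq \<phi>" by (simp add: decseq_Suc_iff mono)
  moreover have "Bseq \<phi>"
    using \<open>decseq \<phi>\<close> bounded by (intro BseqI'[of _ "max \<bar>\<phi> 0\<bar> \<bar>\<phi>min\<bar>"])
      (smt (verit) decseqD le0 real_norm_def)
  ultimately obtain L where "\<phi> \<longlonglongrightarrow> L"
    using Bseq_monoseq_convergent convergent_def decseq_imp_monoseq by metis
  with \<open>decseq \<phi>\<close> that show ?thesis using decseq_ge by blast
qed

lemma \<phi>_antimono: "s \<le> t \<Longrightarrow> \<phi> t \<le> \<phi> s"
  using mono by (rule lift_Suc_antimono_le)

lemma radius_unsuccessful: "\<not> S t \<Longrightarrow> D\<^sub>0 (Suc t) \<le> D t"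
proof (cases "F t")
  case True
  assume "\<not> S t"
  then have "D\<^sub>0 (Suc t) \<le> g * D t" using radius_F True by simp
  also have "\<dots> \<le> 1 * D t" using pos D_pos[of t] by (intro mult_right_mono) auto
  finally show ?thesis by simp
qed (simp add: radius_N)

lemma successful_radius_small:
  assumes "0 < \<delta>"
  shows "\<forall>\<^sub>F t in sequentially. S t \<longrightarrow> D t < \<delta>"
proof -
  \<comment> \<open>By \<open>crit\<close>, a radius of at least \<open>\<delta>\<close> forces
    \<open>v\<close> to be at least this \<open>u\<close>.\<close>
  define u where "u = min ec (\<delta> / \<mu>)"
  have u: "0 < u" using assms pos by (simp add: u_def)
  obtain L where "\<phi> \<longlonglongrightarrow> L" using \<phi>_convergent .
  then have "(\<lambda>t. \<phi> t - \<phi> (Suc t)) \<longlonglongrightarrow> L - L"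
    by (intro tendsto_diff LIMSEQ_Suc)
  moreover have "0 < \<eta> * u * min (u / h) \<delta>"
    using u assms pos by simp
  ultimately have "\<forall>\<^sub>F t in sequentially. \<phi> t - \<phi> (Suc t) < \<eta> * u * min (u / h) \<delta>"
    by (intro order_tendstoD(2)[where y = "L - L"]) simp_all
  then show ?thesis
  proof eventually_elim
    case (elim t)
    show ?case
    proof (intro impI, rule ccontr)
      assume "S t" "\<not> D t < \<delta>"
      then have \<delta>: "\<delta> \<le> D t" by simp
      have "u \<le> v t"
        using crit[of t]
      proof
        assume "D t \<le> \<mu> * v t"
        with \<delta> have "\<delta> / \<mu> \<le> v t" using pos by (simp add: field_simps)
        then show ?thesis by (simp add: u_def)
      qed (simp add: u_def)
      then have "\<eta> * u * min (u / h) \<delta> \<le> \<eta> * v t * min (v t / h) (D t)"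
        using u assms pos \<delta>
        by (intro mult_mono min.mono divide_right_mono) auto
      with decrease[OF \<open>S t\<close>] elim show False by simp
    qed
  qed
qed

text \<open>Only a success can enlarge the radius. If successes recur, late ones start from small
  radii and \<open>gu\<close> limits the enlargement. If they stop, the radii never grow again, and
  recurring failures with fully linear models contract them.\<close>

lemma radius_tendsto_0: "D \<longlonglongrightarrow> 0"
proof (cases "\<forall>n. \<exists>t\<ge>n. S t")
  case True
  show ?thesis
  proof (rule LIMSEQ_I)
    fix r :: real assume "0 < r"
    \<comment> \<open>Enlarging a radius below \<open>\<delta>\<close> by \<open>gu\<close> leaves
      it below \<open>r / 2\<close>.\<close>
    define \<delta> where "\<delta> = r / (2 * gu)"
    have \<delta>: "0 < \<delta>" "gu * \<delta> < r" using \<open>0 < r\<close> pos by (auto simp: \<delta>_def field_simps)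
    obtain n where n: "\<And>t. n \<le> t \<Longrightarrow> S t \<Longrightarrow> D t < \<delta>"
      using successful_radius_small[OF \<delta>(1)] by (auto simp: eventually_sequentially)
    obtain t\<^sub>1 where t\<^sub>1: "n \<le> t\<^sub>1" "S t\<^sub>1" using True by blast
    have S: "D\<^sub>0 (Suc t) \<le> gu * \<delta>" if "n \<le> t" "S t" for t
    proof -
      have "gu * D t \<le> gu * \<delta>" using n[OF that] pos by simp
      with radius_S[OF that(2)] show ?thesis by simp
    qed
    \<comment> \<open>The bound starts at a late success, since earlier radii are uncontrolled. From
      there on a success restores it and any other iteration preserves it.\<close>
    have "D\<^sub>0 (Suc t) \<le> gu * \<delta>" if "t\<^sub>1 \<le> t" for t
      using that
    proof (induction t rule: dec_induct)
      case base
      show ?case using S t\<^sub>1 .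
    next
      case (step t)
      show ?case
      proof (cases "S (Suc t)")
        case True
        then show ?thesis using S[of "Suc t"] step(1) t\<^sub>1(1) by linarith
      next
        case False
        show ?thesis
          using radius_unsuccessful[OF False] D_le[of "Suc t"] step(3) by linarith
      qed
    qed
    note D\<^sub>0 = this
    have "norm (D t - 0) < r" if "Suc t\<^sub>1 \<le> t" for t
    proof -
      obtain t' where "t = Suc t'" "t\<^sub>1 \<le> t'" using \<open>Suc t\<^sub>1 \<le> t\<close> by (cases t) auto
      then show ?thesis using D\<^sub>0[of t'] D_le[of t] D_pos[of t] \<delta>(2) by simp
    qed
    then show "\<exists>no. \<forall>t\<ge>no. norm (D t - 0) < r" by blast
  qed
next
  case False
  then obtain n where n: "\<And>t. n \<le> t \<Longrightarrow> \<not> S t" by blast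
  have dec: "decseq (\<lambda>t. D\<^sub>0 (t + n))"
  proof -
    have "D\<^sub>0 (Suc (t + n)) \<le> D\<^sub>0 (t + n)" for t
      using radius_unsuccessful[OF n, of "t + n"] D_le[of "t + n"] by simp
    then show ?thesis by (simp add: decseq_Suc_iff)
  qed
  have D\<^sub>0_pos: "0 < D\<^sub>0 t" for t
    using D_pos D_le less_le_trans by blast
  obtain L where L: "(\<lambda>t. D\<^sub>0 (t + n)) \<longlonglongrightarrow> L" "\<And>t. L \<le> D\<^sub>0 (t + n)"
    using decseq_convergent[OF dec, of 0] D\<^sub>0_pos less_imp_le by metis
  have "L \<le> 0"
  proof (rule ccontr)
    assume "\<not> L \<le> 0"
    then have "0 < L" by simp
    \<comment> \<open>The locale bounds \<open>g\<close> only from above; the maximum makes division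
      by \<open>q\<close> possible.\<close>
    define q where "q = max g (1/2)"
    have q: "0 < q" "q < 1" "g \<le> q" using pos by (auto simp: q_def)
    with \<open>0 < L\<close> have "L < L / q" by (simp add: field_simps)
    \<comment> \<open>This close to the limit, one contraction undercuts \<open>L\<close>, although
      \<open>L\<close> is a lower bound.\<close>
    then have "\<forall>\<^sub>F t in sequentially. D\<^sub>0 (t + n) < L / q"
      using L(1) by (intro order_tendstoD(2))
    then obtain k where k: "\<And>t. k \<le> t \<Longrightarrow> D\<^sub>0 (t + n) < L / q"
      by (auto simp: eventually_sequentially)
    obtain t where t: "k + n \<le> t" "F t" using inf_often[of "k + n"] n by force
    then have "D\<^sub>0 (Suc t) \<le> g * D t" using radius_F n by simp
    also have "\<dots> \<le> q * D\<^sub>0 t"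
      using q D_le[of t] D_pos[of t] by (intro mult_mono) auto
    also have "\<dots> < L" using k[of "t - n"] t q by (simp add: field_simps)
    also have "L \<le> D\<^sub>0 (Suc t)" using L(2)[of "Suc t - n"] t by simp
    finally show False by simp
  qed
  moreover have "0 \<le> L"
    using L(1) D\<^sub>0_pos by (intro LIMSEQ_le_const) (auto intro: less_imp_le)
  ultimately have "D\<^sub>0 \<longlonglongrightarrow> 0" using L(1) LIMSEQ_offset[of D\<^sub>0 n L] by simp
  moreover have "\<forall>t. norm (D t) \<le> D\<^sub>0 t"
    using D_pos D_le by (simp add: less_imp_le)
  ultimately show ?thesis by (rule Lim_null_comparison[OF always_eventually, rotated])
qed

section \<open>Convergence of the criticality to zero\<close>

lemma v_ge: "e \<le> w t \<Longrightarrow> e / \<kappa> \<le> v t"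
  using w_le[of t] pos by (simp add: field_simps)

text \<open>If \<open>w\<close> stays bounded below, so does \<open>v\<close>, and neither the
  criticality step nor a contraction can push the radius below a fixed \<open>d\<close>, contrary to
  \<open>radius_tendsto_0\<close>.\<close>

lemma w_infinitely_often_small:
  assumes "0 < e"
  shows "\<exists>t\<ge>n. w t < e"
proof (rule ccontr)
  assume "\<not> ?thesis"
  then have v: "e / \<kappa> \<le> v t" if "n \<le> t" for t
    using that by (intro v_ge) force
  \<comment> \<open>The terms are the radius at the start, the floor left by the criticality step,
    and what a contraction, by \<open>gd\<close> at worst, leaves of a radius too large to ensure
    success.\<close>
  define d where "d = min (D\<^sub>0 n) (min (\<beta> * (e / \<kappa>)) (gd * (b * (e / \<kappa>))))"
  have d: "0 < d"
    using assms pos D_pos[of n] D_le[of n] by (simp add: d_def)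
  have step: "d \<le> D t" if "n \<le> t" "d \<le> D\<^sub>0 t" for t
  proof -
    have "\<beta> * (e / \<kappa>) \<le> \<beta> * v t" using v[OF that(1)] pos by (intro mult_left_mono) auto
    with D_ge[of t] that show ?thesis by (simp add: d_def min_def split: if_splits)
  qed
  have "d \<le> D\<^sub>0 t" if "n \<le> t" for t
    using that
  proof (induction t rule: dec_induct)
    case base
    show ?case by (simp add: d_def)
  next
    case (step t)
    then have D: "d \<le> D t" using \<open>\<And>t. n \<le> t \<Longrightarrow> d \<le> D\<^sub>0 t \<Longrightarrow> d \<le> D t\<close> by simp
    show ?case
    proof (cases "\<not> S t \<and> F t")
      case True
      then have "b * v t \<le> D t" using success by force
      moreover have "b * (e / \<kappa>) \<le> b * v t"
        using v step pos by (intro mult_left_mono) auto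
      ultimately have "gd * (b * (e / \<kappa>)) \<le> gd * D t"
        using pos by (intro mult_left_mono) auto
      then show ?thesis using radius_F[of t] True by (simp add: d_def min_le_iff_disj)
    next
      case False
      then show ?thesis using D radius_S[of t] radius_N[of t] by (cases "S t") auto
    qed
  qed
  with step have "\<And>t. n \<le> t \<Longrightarrow> d \<le> D t" by blast
  then have "d \<le> 0" using radius_tendsto_0 by (intro LIMSEQ_le_const) auto
  with d show False by simp
qed

text \<open>
  While \<open>v \<ge> e\<close> and the radii are small, an iterate only moves in successful iterations, where the
  decrease of \<open>\<phi>\<close> is at least proportional to the radius.
\<close>

lemma path_length_le_decrease:
  assumes "0 < e" "s \<le> t"
    and large: "\<And>j. s \<le> j \<Longrightarrow> j < t \<Longrightarrow> e \<le> v j"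
    and small: "\<And>j. s \<le> j \<Longrightarrow> D j \<le> min (b * e) (e / h)"
  shows "\<eta> * e * infnorm (x s - x t) \<le> \<phi> s - \<phi> t"
  using \<open>s \<le> t\<close> large
proof (induction t rule: dec_induct)
  case base
  show ?case by (simp add: infnorm_0)
next
  case (step j)
  have e: "e \<le> v j" and D: "D j \<le> b * e" "D j \<le> e / h" using step small[of j] by auto
  have "\<eta> * e * infnorm (x (Suc j) - x j) \<le> \<phi> j - \<phi> (Suc j)"
  proof (cases "S j")
    case True
    \<comment> \<open>The radius becomes the smaller term of the minimum, so the decrease is linear
      in it.\<close>
    have "D j \<le> v j / h" using D e pos by (smt (verit) divide_right_mono)
    then have "\<eta> * v j * D j \<le> \<phi> j - \<phi> (Suc j)" using decrease[OF True] by (simp add: min_absorb2)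
    moreover have "\<eta> * e * infnorm (x (Suc j) - x j) \<le> \<eta> * v j * D j"
      using iterate e pos \<open>0 < e\<close> by (intro mult_mono) (auto simp: infnorm_pos_le)
    ultimately show ?thesis by simp
  next
    case False
    have "b * e \<le> b * v j" using e pos by simp
    then have "\<not> F j" using success[of j] D False by auto
    then show ?thesis using False iterate_N[of j] mono[of j] by (simp add: infnorm_0)
  qed
  moreover have "infnorm (x s - x (Suc j)) \<le> infnorm (x s - x j) + infnorm (x (Suc j) - x j)"
    using infnorm_triangle[of "x s - x j" "x j - x (Suc j)"] by (simp add: infnorm_sub)
  then have "\<eta> * e * infnorm (x s - x (Suc j))
      \<le> \<eta> * e * (infnorm (x s - x j) + infnorm (x (Suc j) - x j))"
    using pos \<open>0 < e\<close> by (intro mult_left_mono) auto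
  moreover have "\<eta> * e * infnorm (x s - x j) \<le> \<phi> s - \<phi> j"
    using step by simp
  ultimately show ?case by (simp add: distrib_left)
qed

theorem w_tendsto_0: "w \<longlonglongrightarrow> 0"
proof (rule LIMSEQ_I, rule ccontr)
  fix r :: real
  assume "0 < r" and "\<not> (\<exists>n. \<forall>t\<ge>n. norm (w t - 0) < r)"
  then have often: "\<exists>t\<ge>n. r \<le> w t" for n
    using w_nonneg by (force simp: not_less)
  \<comment> \<open>A lower bound for \<open>v\<close> as long as \<open>w\<close> is at least
    \<open>r / 2\<close>.\<close>
  define e where "e = (r / 2) / \<kappa>"
  have e: "0 < e" using \<open>0 < r\<close> pos by (simp add: e_def)
  obtain L where L: "\<phi> \<longlonglongrightarrow> L" "\<And>t. L \<le> \<phi> t"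
    using \<phi>_convergent by metis
  \<comment> \<open>A decrease of \<open>\<phi>\<close> below \<open>a\<close> limits the distance
    to less than \<open>(r / 2) / (K + 1)\<close>, over which \<open>w\<close> changes by less than
    \<open>r / 2\<close>. Adding 1 covers \<open>K = 0\<close>.\<close>
  define a where "a = \<eta> * e * (r / 2) / (K + 1)"
  have a: "0 < a" using e \<open>0 < r\<close> pos by (simp add: a_def)
  have "\<forall>\<^sub>F t in sequentially. D t < min (b * e) (e / h) \<and> \<phi> t < L + a"
    using e pos a radius_tendsto_0 L(1)
    by (intro eventually_conj order_tendstoD(2)) auto
  then obtain n where n: "\<And>t. n \<le> t \<Longrightarrow> D t < min (b * e) (e / h)" "\<And>t. n \<le> t \<Longrightarrow> \<phi> t < L + a"
    by (auto simp: eventually_sequentially)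
  obtain s where s: "n \<le> s" "r \<le> w s" using often by blast
  \<comment> \<open>Minimality keeps \<open>w\<close> at least \<open>r / 2\<close> from
    \<open>s\<close> up to, but excluding, \<open>t\<close>.\<close>
  define t where "t = (LEAST t. s \<le> t \<and> w t < r / 2)"
  have t: "s \<le> t" "w t < r / 2"
    using LeastI_ex[of "\<lambda>t. s \<le> t \<and> w t < r / 2"] w_infinitely_often_small[of "r / 2" s] \<open>0 < r\<close>
    unfolding t_def by auto
  have "e \<le> v j" if "s \<le> j" "j < t" for j
    using not_less_Least[of j "\<lambda>t. s \<le> t \<and> w t < r / 2"] that
    unfolding e_def by (intro v_ge) (auto simp: t_def)
  moreover have "D j \<le> min (b * e) (e / h)" if "s \<le> j" for j
    using n(1)[of j] that s(1) by simp
  ultimately have "\<eta> * e * infnorm (x s - x t) \<le> \<phi> s - \<phi> t"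
    by (intro path_length_le_decrease e t(1))
  also have "\<dots> < a" using n(2)[OF s(1)] L(2)[of t] by simp
  finally have "\<eta> * e * infnorm (x s - x t) < \<eta> * e * ((r / 2) / (K + 1))"
    by (simp add: a_def)
  moreover have "0 < \<eta> * e" using e pos by simp
  ultimately have "infnorm (x s - x t) < (r / 2) / (K + 1)"
    by (rule mult_left_less_imp_less[OF _ less_imp_le])
  moreover have "0 < K + 1" using pos by simp
  ultimately have "infnorm (x s - x t) * (K + 1) < r / 2"
    by (simp only: pos_less_divide_eq)
  then have "K * infnorm (x s - x t) < r / 2"
    using infnorm_pos_le[of "x s - x t"] by (simp add: algebra_simps)
  then show False
    using w_lipschitz[of s t] s(2) t(2) by linarith
qed

end


section \<open>The trust region algorithm\<close>

text \<open>\<open>model_improvement\<close> speaks of exactly \<open>N\<close> steps. Fully linear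
  models are fixed points of the improvement, so longer runs are covered too; this matters because
  components may take different numbers of steps.\<close>

lemma fully_linear_relpowp:
  assumes imp: "model_improvement X \<Delta>ub C g"
  obtains N where "\<And>x \<Delta> k m m'. \<lbrakk>x \<in> X; \<Delta> \<in> {0<..\<Delta>ub}; m \<in> models C; N \<le> k;
    (improve C x \<Delta> ^^ k) m m'\<rbrakk> \<Longrightarrow> fully_linear X C g x \<Delta> m'"
proof -
  obtain N where N: "\<And>x \<Delta> (M :: nat \<Rightarrow> real^'a \<Rightarrow> real). \<lbrakk>x \<in> X; \<Delta> \<in> {0<..\<Delta>ub}; M 0 \<in> models C;
      \<And>i. i < N \<Longrightarrow> improve C x \<Delta> (M i) (M (Suc i))\<rbrakk> \<Longrightarrow> fully_linear X C g x \<Delta> (M N)"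
    using imp unfolding model_improvement_def by blast
  have fixed: "m' = m" if "x \<in> X" "\<Delta> \<in> {0<..\<Delta>ub}" "fully_linear X C g x \<Delta> m" "improve C x \<Delta> m m'"
    for x \<Delta> m m'
    using imp that unfolding model_improvement_def fully_linear_def by blast
  show ?thesis
  proof (rule that)
    fix x \<Delta> k m m'
    assume *: "x \<in> X" "\<Delta> \<in> {0<..\<Delta>ub}" "m \<in> models C" "N \<le> k" "(improve C x \<Delta> ^^ k) m m'"
    obtain M where M: "M 0 = m" "M k = m'" "\<And>i. i < k \<Longrightarrow> improve C x \<Delta> (M i) (M (Suc i))"
      using *(5) unfolding relpowp_fun_conv by blast
    have "fully_linear X C g x \<Delta> (M j)" if "N \<le> j" "j \<le> k" for j
      using that
    proof (induction j rule: dec_induct)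
      case base
      show ?case using * M by (intro N) auto
    next
      case (step j)
      with fixed[of x \<Delta> "M j" "M (Suc j)"] M(3)[of j] * show ?case by simp
    qed
    with M *(4) show "fully_linear X C g x \<Delta> m'" by blast
  qed
qed

lemma Phi_diff_le:
  assumes "\<And>l. \<bar>f l \<xi> - m l \<xi>\<bar> \<le> e"
  shows "\<bar>Phi f \<xi> - Phi m \<xi>\<bar> \<le> e"
proof -
  have "f l \<xi> \<le> m l \<xi> + e" "m l \<xi> \<le> f l \<xi> + e" for l
    using assms[of l] by linarith+
  then have "Phi f \<xi> \<le> Phi m \<xi> + e" "Phi m \<xi> \<le> Phi f \<xi> + e"
    unfolding Phi_def by (blast intro: Max_range_le_add)+
  then show ?thesis by linarith
qed

text \<open>The final radius is no smaller than that of the last loop, so full linearity passes to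
  it by the inheritance clause of \<open>fully_linear_class\<close>. The bound by \<open>mu\<close>
  combines the stopping test with \<open>beta P < mu P\<close>.\<close>

lemma crit_resultD:
  assumes P: "valid_params P" and "x \<in> X" "0 < \<Delta>s" "\<Delta>s \<le> Delta_ub P"
    and flc: "\<And>l. fully_linear_class X (Delta_ub P) (C l) (f l)"
    and res: "crit_result P X C f x \<Delta>s m \<Delta>"
  shows "fully_linear_all X C f x \<Delta> m" "0 < \<Delta>" "\<Delta> \<le> \<Delta>s" "\<Delta> \<le> mu P * varpi X m x"
    "min (beta P * varpi X m x) \<Delta>s \<le> \<Delta>"
proof -
  obtain J r where J: "1 \<le> J" "fully_linear_all X C f x (alpha P ^ (J - 1) * \<Delta>s) (r J)"
    "alpha P ^ (J - 1) * \<Delta>s \<le> mu P * varpi X (r J) x" "m = r J"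
    "\<Delta> = min (max (alpha P ^ (J - 1) * \<Delta>s) (beta P * varpi X m x)) \<Delta>s"
    using res unfolding crit_result_def by (metis atLeastAtMost_iff order_refl)
  define \<delta> where "\<delta> = alpha P ^ (J - 1) * \<Delta>s"
  have "alpha P ^ (J - 1) \<le> 1" "0 < alpha P ^ (J - 1)"
    using P by (auto simp: valid_params_def intro: power_le_one)
  then have \<delta>: "0 < \<delta>" "\<delta> \<le> \<Delta>s"
    using \<open>0 < \<Delta>s\<close> by (auto simp: \<delta>_def)
  have \<Delta>: "\<Delta> = min (max \<delta> (beta P * varpi X m x)) \<Delta>s" by (simp add: J \<delta>_def)
  with \<delta> have "\<delta> \<le> \<Delta>" by simp
  with \<delta> show "0 < \<Delta>" by simp
  show le: "\<Delta> \<le> \<Delta>s" using \<Delta> by simp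
  show "min (beta P * varpi X m x) \<Delta>s \<le> \<Delta>" using \<Delta> by auto
  have "beta P * varpi X m x \<le> mu P * varpi X m x"
    using P varpi_nonneg[OF \<open>x \<in> X\<close>] by (intro mult_right_mono) (auto simp: valid_params_def)
  then show "\<Delta> \<le> mu P * varpi X m x" using \<Delta> J by (auto simp: \<delta>_def)
  have "fully_linear X (C l) (f l) x \<delta> (m l)" for l
    using J by (simp add: fully_linear_all_def \<delta>_def)
  moreover have "\<delta> \<in> {0<..Delta_ub P}" "\<Delta> \<in> {\<delta>..Delta_ub P}"
    using \<delta> \<open>\<delta> \<le> \<Delta>\<close> le assms(4) by auto
  ultimately show "fully_linear_all X C f x \<Delta> m"
    using flc \<open>x \<in> X\<close> unfolding fully_linear_all_def fully_linear_class_def by blast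
qed

text \<open>The model error is quadratic in the radius, the predicted decrease at least linear. The
  last bound on \<open>\<Delta>\<close> keeps the errors at \<open>x\<close> and
  \<open>x + s\<close> together within the share \<open>1 - \<nu>\<close> of that decrease.\<close>

lemma rho_ge_if_small_radius:
  fixes f m :: "'k::finite \<Rightarrow> real^'n \<Rightarrow> real"
  assumes fl: "fully_linear_all X C f x \<Delta> m"
    and eps: "\<And>l. eps_val (C l) \<le> e"
    and x: "x \<in> X" "x + s \<in> tr_ball X x \<Delta>" and "0 < \<Delta>"
    and decrease: "Phi m x - Phi m (x + s) \<ge> \<kappa> * v * min (v / h) \<Delta>"
    and "0 < \<kappa>" "0 < v" "\<nu> < 1"
    and \<Delta>: "\<Delta> \<le> v / h" "2 * e * \<Delta> \<le> (1 - \<nu>) * \<kappa> * v"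
  shows "\<nu> \<le> rho f m x s"
proof -
  define M where "M = Phi m x - Phi m (x + s)"
  have "\<kappa> * v * \<Delta> \<le> M" using decrease \<Delta> by (simp add: M_def min_absorb2)
  moreover have "0 < \<kappa> * v * \<Delta>" using assms by simp
  ultimately have "0 < M" by simp
  then have "x + s \<noteq> x" by (auto simp: M_def)
  have close: "\<bar>Phi f \<xi> - Phi m \<xi>\<bar> \<le> e * \<Delta>\<^sup>2" if "\<xi> \<in> tr_ball X x \<Delta>" for \<xi>
  proof (rule Phi_diff_le)
    fix l
    have "\<bar>f l \<xi> - m l \<xi>\<bar> \<le> eps_val (C l) * \<Delta>\<^sup>2"
      using fl that by (simp add: fully_linear_all_def fully_linear_def)
    also have "\<dots> \<le> e * \<Delta>\<^sup>2" using eps by (intro mult_right_mono) auto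
    finally show "\<bar>f l \<xi> - m l \<xi>\<bar> \<le> e * \<Delta>\<^sup>2" .
  qed
  have "x \<in> tr_ball X x \<Delta>" using x \<open>0 < \<Delta>\<close> by (simp add: tr_ball_def infnorm_0)
  then have "M - 2 * e * \<Delta> * \<Delta> \<le> Phi f x - Phi f (x + s)"
    using close[of x] close[OF x(2)] by (simp add: M_def power2_eq_square algebra_simps)
  moreover have "2 * e * \<Delta> * \<Delta> \<le> (1 - \<nu>) * \<kappa> * v * \<Delta>"
    using \<Delta>(2) \<open>0 < \<Delta>\<close> by (intro mult_right_mono) auto
  moreover have "(1 - \<nu>) * (\<kappa> * v * \<Delta>) \<le> (1 - \<nu>) * M"
    using \<open>\<kappa> * v * \<Delta> \<le> M\<close> \<open>\<nu> < 1\<close> by (intro mult_left_mono) auto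
  ultimately have "\<nu> * M \<le> Phi f x - Phi f (x + s)"
    by (simp add: algebra_simps)
  then show ?thesis
    using \<open>0 < M\<close> \<open>x + s \<noteq> x\<close> by (simp add: rho_def M_def pos_le_divide_eq)
qed

text \<open>Otherwise every iteration from \<open>n\<close> on merely improves the models for one
  fixed ball, which must succeed after boundedly many steps. The premise of \<open>step\<close> on
  iteration \<open>Suc t\<close> is there to exclude an intervening criticality routine, whose
  result would be fully linear.\<close>

lemma infinitely_often_not_model_improving:
  fixes X :: "(real^'n) set" and f :: "'k::finite \<Rightarrow> real^'n \<Rightarrow> real"
  assumes imp: "\<And>l. model_improvement X \<Delta>ub (C l) (f l)"
    and m: "\<And>t l. m t l \<in> models (C l)"
    and x: "\<And>t. x t \<in> X" and \<Delta>: "\<And>t. \<Delta> t \<in> {0<..\<Delta>ub}"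
    and step: "\<And>t. \<not> S t \<Longrightarrow> \<not> fully_linear_all X C f (x t) (\<Delta> t) (m t) \<Longrightarrow>
      \<not> fully_linear_all X C f (x (Suc t)) (\<Delta> (Suc t)) (m (Suc t)) \<Longrightarrow>
      x (Suc t) = x t \<and> \<Delta> (Suc t) = \<Delta> t \<and>
      (\<forall>l. (improve (C l) (x t) (\<Delta> t))\<^sup>+\<^sup>+ (m t l) (m (Suc t) l))"
  shows "\<exists>t\<ge>n. S t \<or> fully_linear_all X C f (x t) (\<Delta> t) (m t)"
proof (rule ccontr)
  assume "\<not> ?thesis"
  then have no: "\<not> S t" "\<not> fully_linear_all X C f (x t) (\<Delta> t) (m t)" if "n \<le> t" for t
    using that by auto
  \<comment> \<open>The exponent \<open>j\<close> may exceed \<open>k\<close>: an iteration performs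
    at least one improvement step but possibly several.\<close>
  have "x (n + k) = x n \<and> \<Delta> (n + k) = \<Delta> n \<and>
      (\<forall>l. \<exists>j\<ge>k. (improve (C l) (x n) (\<Delta> n) ^^ j) (m n l) (m (n + k) l))" for k
  proof (induction k)
    case 0
    show ?case by (auto intro!: exI[of _ "0::nat"])
  next
    case (Suc k)
    have "\<exists>j\<ge>Suc k. (improve (C l) (x n) (\<Delta> n) ^^ j) (m n l) (m (n + Suc k) l)" for l
    proof -
      obtain j where j: "k \<le> j" "(improve (C l) (x n) (\<Delta> n) ^^ j) (m n l) (m (n + k) l)"
        using Suc by blast
      have "(improve (C l) (x n) (\<Delta> n))\<^sup>+\<^sup>+ (m (n + k) l) (m (n + Suc k) l)"
        using step[of "n + k"] no[of "n + k"] no(2)[of "Suc (n + k)"] Suc by simp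
      then obtain i where i: "0 < i"
        "(improve (C l) (x n) (\<Delta> n) ^^ i) (m (n + k) l) (m (n + Suc k) l)"
        by (auto simp: tranclp_power)
      then have "(improve (C l) (x n) (\<Delta> n) ^^ (j + i)) (m n l) (m (n + Suc k) l)"
        using j(2) by (auto simp: relpowp_add)
      then show ?thesis using i(1) j(1) by (intro exI[of _ "j + i"]) simp
    qed
    then show ?case
      using step[of "n + k"] no[of "n + k"] no(2)[of "Suc (n + k)"] Suc by simp
  qed
  note chain = this
  have "\<exists>N. \<forall>k m m'. m \<in> models (C l) \<longrightarrow> N \<le> k \<longrightarrow> (improve (C l) (x n) (\<Delta> n) ^^ k) m m' \<longrightarrow>
      fully_linear X (C l) (f l) (x n) (\<Delta> n) m'" for l
    using fully_linear_relpowp[OF imp[of l]] x \<Delta> by metis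
  then obtain N where N: "\<And>l k m m'. \<lbrakk>m \<in> models (C l); N l \<le> k;
      (improve (C l) (x n) (\<Delta> n) ^^ k) m m'\<rbrakk> \<Longrightarrow> fully_linear X (C l) (f l) (x n) (\<Delta> n) m'"
    by metis
  \<comment> \<open>There are finitely many components, so one number of iterations serves them
    all.\<close>
  define k where "k = (MAX l. N l)"
  have "fully_linear X (C l) (f l) (x n) (\<Delta> n) (m (n + k) l)" for l
  proof -
    obtain j where "k \<le> j" "(improve (C l) (x n) (\<Delta> n) ^^ j) (m n l) (m (n + k) l)"
      using chain by blast
    moreover have "N l \<le> k" by (simp add: k_def)
    ultimately show ?thesis using N m by (meson order_trans)
  qed
  then have "fully_linear_all X C f (x (n + k)) (\<Delta> (n + k)) (m (n + k))"
    using chain[of k] by (simp add: fully_linear_all_def)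
  with no(2)[of "n + k"] show False by simp
qed

section \<open>Convergence for runs of the algorithm\<close>

theorem theorem6:
  fixes X :: "(real^'n) set"
    and f :: "'k::finite \<Rightarrow> real^'n \<Rightarrow> real"
    and P :: tr_params
    and C :: "'k \<Rightarrow> 'n model_class"
    and x s :: "nat \<Rightarrow> real^'n"
    and m\<^sub>0 m :: "nat \<Rightarrow> 'k \<Rightarrow> real^'n \<Rightarrow> real"
    and \<Delta>\<^sub>0 \<Delta> :: "nat \<Rightarrow> real"
    and T :: enat
    and c H\<^sub>m \<kappa>\<^sub>m \<kappa>\<^sub>\<omega> :: real
  assumes X: "X = UNIV \<or> (closed X \<and> bounded X \<and> convex X)"
    and c: "0 < c" "\<And>v :: real^'n. norm v \<le> sqrt c * infnorm v"
    and f_C1: "\<exists>U. open U \<and> X \<subseteq> U \<and> (\<forall>l. C1_on U (f l))"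
    and f_lip: "\<And>l. \<exists>L. infnorm_lipschitz_on L X (grad (f l))"
    and f_bdd: "bdd_below (Phi f ` X)"
    and params: "valid_params P"
    and run: "tr_run P X C f x m\<^sub>0 \<Delta>\<^sub>0 m \<Delta> s T"
    and fully_lin: "\<And>l. fully_linear_class X (Delta_ub P) (C l) (f l)"
      "\<And>t l. m t l \<in> models (C l)"
    and m_C2: "\<And>t l. \<exists>U. open U \<and> X \<subseteq> U \<and> C2_on U (m t l)"
    and hess: "0 < H\<^sub>m" "1 < c * H\<^sub>m"
      "\<And>t l \<xi>. \<xi> \<in> tr_ball X (x t) (\<Delta> t) \<Longrightarrow> norm (hessian (m t l) \<xi>) \<le> H\<^sub>m"
    and kappa_m: "0 < \<kappa>\<^sub>m" "\<kappa>\<^sub>m < 1"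
    and step_in: "\<And>t. enat t < T \<Longrightarrow> x t + s t \<in> tr_ball X (x t) (\<Delta> t)"
    and step_decrease: "\<And>t. enat t < T \<Longrightarrow>
      Phi (m t) (x t) - Phi (m t) (x t + s t) \<ge>
        \<kappa>\<^sub>m * varpi X (m t) (x t) * min (varpi X (m t) (x t) / (c * H\<^sub>m)) (\<Delta> t)"
    and kappa_omega: "0 < \<kappa>\<^sub>\<omega>"
      "\<And>t. \<bar>omega X (m t) (x t) - omega X f (x t)\<bar> \<le> \<kappa>\<^sub>\<omega> * omega X (m t) (x t)"
  shows "(\<lambda>t. varpi X f (x t)) \<longlonglongrightarrow> 0"
proof -
  define v where "v t = varpi X (m t) (x t)" for t
  define S where "S t \<longleftrightarrow> nu_pp P \<le> rho f (m t) (x t) (s t)" for t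
  define F where "F t \<longleftrightarrow> fully_linear_all X C f (x t) (\<Delta> t) (m t)" for t
  have P: "0 < eps_crit P" "0 < beta P" "0 < mu P" "0 \<le> nu_p P" "0 < nu_pp P" "nu_pp P < 1"
    "0 < gamma_ddown P" "gamma_down P < 1" "1 \<le> gamma_up P" "0 < alpha P" "alpha P < 1"
    using params by (auto simp: valid_params_def)
  have start: "x 0 \<in> X" "0 < \<Delta>\<^sub>0 0" "\<Delta>\<^sub>0 0 \<le> Delta_ub P"
    and improving: "\<And>t l. enat (Suc t) \<le> T \<Longrightarrow> \<not> S t \<Longrightarrow> \<not> F t \<Longrightarrow>
      (improve (C l) (x (Suc t)) (\<Delta>\<^sub>0 (Suc t)))\<^sup>+\<^sup>+ (m t l) (m\<^sub>0 (Suc t) l)"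
    and crit: "\<And>t. enat t < T \<Longrightarrow> if crit_entered P X C f (x t) (\<Delta>\<^sub>0 t) (m\<^sub>0 t)
         then crit_result P X C f (x t) (\<Delta>\<^sub>0 t) (m t) (\<Delta> t)
         else m t = m\<^sub>0 t \<and> \<Delta> t = \<Delta>\<^sub>0 t"
    and update: "\<And>t. enat t < T \<Longrightarrow>
      tr_update P X C f (x t) (m t) (\<Delta> t) (s t) (x (Suc t)) (\<Delta>\<^sub>0 (Suc t))"
    using run unfolding tr_run_def model_improving_def S_def F_def by (blast, blast, blast, force, blast, blast)
  have next_iterate: "x (Suc t) = x t + s t \<or> x (Suc t) = x t" if "enat t < T" for t
    using update[OF that] by (auto simp: tr_update_def)
  have radius_S: "\<Delta>\<^sub>0 (Suc t) \<in> {\<Delta> t..min (gamma_up P * \<Delta> t) (Delta_ub P)}"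
    if "enat t < T" "S t" "0 < \<Delta> t" "\<Delta> t \<le> Delta_ub P" for t
  proof -
    \<comment> \<open>Both success branches land in the same interval: the forced value is its right
      end, which is at least \<open>\<Delta> t\<close>.\<close>
    have "\<Delta> t \<le> gamma_up P * \<Delta> t" using P that by simp
    with update[OF that(1)] that show ?thesis
      by (auto simp: tr_update_def S_def split: if_splits)
  qed
  have radius_F: "\<Delta>\<^sub>0 (Suc t) \<in> {gamma_ddown P * \<Delta> t..gamma_down P * \<Delta> t}"
    if "enat t < T" "\<not> S t" "F t" for t
    using update[OF that(1)] that by (auto simp: tr_update_def S_def F_def)
  have radius_N: "\<Delta>\<^sub>0 (Suc t) = \<Delta> t" "x (Suc t) = x t" if "enat t < T" "\<not> S t" "\<not> F t" for t
    using update[OF that(1)] that by (auto simp: tr_update_def S_def F_def)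
  \<comment> \<open>The last disjunction records that without full linearity the routine was not
    run, so model and radius are those on entry.\<close>
  have after_crit: "0 < \<Delta> t \<and> \<Delta> t \<le> \<Delta>\<^sub>0 t \<and> min (beta P * v t) (\<Delta>\<^sub>0 t) \<le> \<Delta> t \<and>
      (eps_crit P \<le> v t \<or> \<Delta> t \<le> mu P * v t) \<and> (F t \<or> m t = m\<^sub>0 t \<and> \<Delta> t = \<Delta>\<^sub>0 t)"
    if "enat t < T" "x t \<in> X" "0 < \<Delta>\<^sub>0 t" "\<Delta>\<^sub>0 t \<le> Delta_ub P" for t
  proof (cases "crit_entered P X C f (x t) (\<Delta>\<^sub>0 t) (m\<^sub>0 t)")
    case True
    with crit[OF that(1)] have "crit_result P X C f (x t) (\<Delta>\<^sub>0 t) (m t) (\<Delta> t)" by simp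
    from crit_resultD[OF params that(2-4) fully_lin(1) this] show ?thesis
      by (simp add: v_def F_def)
  next
    case False
    with crit[OF that(1)] have eq: "m t = m\<^sub>0 t" "\<Delta> t = \<Delta>\<^sub>0 t" by auto
    with False have "eps_crit P \<le> v t \<or> \<Delta> t \<le> mu P * v t"
      by (auto simp: crit_entered_def v_def)
    with eq that show ?thesis by simp
  qed
  \<comment> \<open>\<open>T\<close> itself is included, because feasibility on entry is used when
    the routine of iteration \<open>T\<close> runs forever.\<close>
  have feasible: "x t \<in> X \<and> 0 < \<Delta>\<^sub>0 t \<and> \<Delta>\<^sub>0 t \<le> Delta_ub P" if "enat t \<le> T" for t
    using that
  proof (induction t)
    case 0
    show ?case using start by simp
  next
    case (Suc t)
    then have t: "enat t < T" by (simp add: Suc_ile_eq)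
    with Suc have IH: "x t \<in> X" "0 < \<Delta>\<^sub>0 t" "\<Delta>\<^sub>0 t \<le> Delta_ub P" by auto
    have D: "0 < \<Delta> t" "\<Delta> t \<le> Delta_ub P" using after_crit[OF t IH] IH by auto
    have "0 < \<Delta>\<^sub>0 (Suc t) \<and> \<Delta>\<^sub>0 (Suc t) \<le> Delta_ub P"
    proof -
      consider "S t" | "\<not> S t" "F t" | "\<not> S t" "\<not> F t" by blast
      then show ?thesis
      proof cases
        case 1
        with radius_S[OF t 1 D] D show ?thesis by simp
      next
        case 2
        have "0 < gamma_ddown P * \<Delta> t" using P D by simp
        moreover have "gamma_down P * \<Delta> t \<le> \<Delta> t" using P D by simp
        ultimately show ?thesis using radius_F[OF t 2] D(2) unfolding atLeastAtMost_iff by linarith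
      next
        case 3
        with radius_N[OF t 3] D show ?thesis by simp
      qed
    qed
    moreover have "x (Suc t) \<in> X"
      using next_iterate[OF t] step_in[OF t] IH by (auto simp: tr_ball_def)
    ultimately show ?case by blast
  qed
  \<comment> \<open>Truncation at 1 preserves the estimate because the factor is at least 1.\<close>
  have varpi_le: "varpi X f (x t) \<le> (1 + \<kappa>\<^sub>\<omega>) * v t" for t
  proof -
    have "omega X f (x t) \<le> (1 + \<kappa>\<^sub>\<omega>) * omega X (m t) (x t)"
      using kappa_omega(2)[of t] by (simp add: algebra_simps)
    then show ?thesis
      using kappa_omega(1) by (simp add: v_def varpi_def min_def)
  qed
  show ?thesis
  proof (cases T)
    case (enat n)
    have n: "x n \<in> X" using feasible enat by simp
    have loop: "x (n + j) = x n" "\<Delta> (n + j) = alpha P ^ (j - 1) * \<Delta>\<^sub>0 n"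
      "mu P * varpi X (m (n + j)) (x n) < \<Delta> (n + j)" if "1 \<le> j" for j
      using run that enat unfolding tr_run_def by auto
    have "(\<lambda>j. (1 + \<kappa>\<^sub>\<omega>) * (alpha P ^ j * \<Delta>\<^sub>0 n / mu P)) \<longlonglongrightarrow> (1 + \<kappa>\<^sub>\<omega>) * (0 * \<Delta>\<^sub>0 n / mu P)"
      using P by (intro tendsto_intros LIMSEQ_power_zero) auto
    then have lim: "(\<lambda>j. (1 + \<kappa>\<^sub>\<omega>) * (alpha P ^ j * \<Delta>\<^sub>0 n / mu P)) \<longlonglongrightarrow> 0" by simp
    \<comment> \<open>The failed stopping test bounds the model criticality by the loop radius over
      \<open>mu P\<close>. Loops start at offset 1, so the exponent at index
      \<open>j + Suc n\<close> is \<open>j\<close>.\<close>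
    have "varpi X f (x (j + Suc n)) \<le> (1 + \<kappa>\<^sub>\<omega>) * (alpha P ^ j * \<Delta>\<^sub>0 n / mu P)" for j
    proof -
      have "v (n + Suc j) \<le> alpha P ^ j * \<Delta>\<^sub>0 n / mu P"
        using loop[of "Suc j"] P by (simp add: v_def pos_le_divide_eq mult.commute less_imp_le)
      then have "(1 + \<kappa>\<^sub>\<omega>) * v (n + Suc j) \<le> (1 + \<kappa>\<^sub>\<omega>) * (alpha P ^ j * \<Delta>\<^sub>0 n / mu P)"
        using kappa_omega(1) by (intro mult_left_mono) auto
      with varpi_le[of "n + Suc j"] show ?thesis by (simp add: add.commute)
    qed
    moreover have "0 \<le> varpi X f (x (j + Suc n))" for j
      using varpi_nonneg[OF n] loop(1)[of "Suc j"] by (simp add: add.commute)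
    ultimately have "(\<lambda>j. varpi X f (x (j + Suc n))) \<longlonglongrightarrow> 0"
      by (intro tendsto_sandwich[OF _ _ tendsto_const lim]) auto
    then show ?thesis by (rule LIMSEQ_offset)
  next
    case infinity
    then have T: "enat t < T" for t by simp
    have in_X: "x t \<in> X" and \<Delta>\<^sub>0: "0 < \<Delta>\<^sub>0 t" "\<Delta>\<^sub>0 t \<le> Delta_ub P" for t
      using feasible[of t] T[of t] by auto
    note after_crit = after_crit[OF T in_X \<Delta>\<^sub>0]
    have \<Delta>: "0 < \<Delta> t" "\<Delta> t \<le> Delta_ub P" for t
      using after_crit[of t] \<Delta>\<^sub>0[of t] by auto
    \<comment> \<open>Neither alternative left by the criticality step allows
      \<open>v t = 0\<close>. Hence a positive decrease is predicted, the step is nonzero and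
      \<open>rho\<close> is a proper quotient.\<close>
    have v_pos: "0 < v t" for t
    proof -
      from after_crit[of t] consider "eps_crit P \<le> v t" | "\<Delta> t \<le> mu P * v t" by blast
      then show ?thesis
      proof cases
        case 2
        with \<Delta>(1)[of t] have "0 < mu P * v t" by linarith
        with P show ?thesis by (simp add: zero_less_mult_iff)
      qed (use P in linarith)
    qed
    have cH: "0 < c * H\<^sub>m" using c hess by simp
    define M where "M t = Phi (m t) (x t) - Phi (m t) (x t + s t)" for t
    have M_ge: "\<kappa>\<^sub>m * v t * min (v t / (c * H\<^sub>m)) (\<Delta> t) \<le> M t" for t
      using step_decrease[OF T] by (simp add: M_def v_def)
    have M_pos: "0 < M t" for t
    proof -
      have "0 < \<kappa>\<^sub>m * v t * min (v t / (c * H\<^sub>m)) (\<Delta> t)"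
        using kappa_m v_pos \<Delta> cH by simp
      with M_ge[of t] show ?thesis by linarith
    qed
    have rho: "rho f (m t) (x t) (s t) = (Phi f (x t) - Phi f (x t + s t)) / M t" for t
      using M_pos[of t] by (auto simp: rho_def M_def)
    have decrease: "nu_pp P * \<kappa>\<^sub>m * v t * min (v t / (c * H\<^sub>m)) (\<Delta> t)
        \<le> Phi f (x t) - Phi f (x (Suc t))" if "S t" for t
    proof -
      have "x (Suc t) = x t + s t" using update[OF T, of t] that by (simp add: tr_update_def S_def)
      with that M_pos[of t] have "nu_pp P * M t \<le> Phi f (x t) - Phi f (x (Suc t))"
        by (simp add: S_def rho pos_le_divide_eq)
      moreover have "nu_pp P * (\<kappa>\<^sub>m * v t * min (v t / (c * H\<^sub>m)) (\<Delta> t)) \<le> nu_pp P * M t"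
        using M_ge P by (intro mult_left_mono) auto
      ultimately show ?thesis by (simp add: mult.assoc)
    qed
    have mono: "Phi f (x (Suc t)) \<le> Phi f (x t)" for t
    proof (cases "x (Suc t) = x t")
      case False
      \<comment> \<open>An iterate moves only if \<open>rho\<close> is at least
        \<open>nu_p P\<close>, which may be zero; this still excludes an increase of the
        objective.\<close>
      with update[OF T, of t] have "x (Suc t) = x t + s t" "0 \<le> rho f (m t) (x t) (s t)"
        using P by (auto simp: tr_update_def split: if_splits)
      with M_pos[of t] show ?thesis by (simp add: rho zero_le_divide_iff)
    qed simp
    define e where "e = (\<Sum>l\<in>UNIV. eps_val (C l))"
    have eps: "0 < eps_val (C l)" for l
      using fully_lin(1)[of l] by (simp add: fully_linear_class_def)
    have e: "0 < e" "eps_val (C l) \<le> e" for l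
      unfolding e_def
      by (intro sum_pos member_le_sum; simp add: eps less_imp_le)+
    \<comment> \<open>The first term makes the radius the smaller term in the sufficient decrease;
      the second keeps the model error within the share \<open>1 - nu_pp P\<close> of it.\<close>
    define b where "b = min (1 / (c * H\<^sub>m)) ((1 - nu_pp P) * \<kappa>\<^sub>m / (2 * e))"
    have success: "S t" if "F t" "\<Delta> t \<le> b * v t" for t
      unfolding S_def
    proof (rule rho_ge_if_small_radius)
      have "b * v t \<le> 1 / (c * H\<^sub>m) * v t" "b * v t \<le> (1 - nu_pp P) * \<kappa>\<^sub>m / (2 * e) * v t"
        using v_pos[of t] by (intro mult_right_mono; simp add: b_def)+
      then have "\<Delta> t \<le> 1 / (c * H\<^sub>m) * v t" "\<Delta> t \<le> (1 - nu_pp P) * \<kappa>\<^sub>m / (2 * e) * v t"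
        using that(2) by linarith+
      with e(1) cH show "\<Delta> t \<le> v t / (c * H\<^sub>m)" "2 * e * \<Delta> t \<le> (1 - nu_pp P) * \<kappa>\<^sub>m * v t"
        by (auto simp: field_simps)
    qed (use that in_X step_in[OF T] \<Delta> M_ge kappa_m v_pos P e in \<open>auto simp: F_def M_def\<close>)
    have inf_often: "\<exists>t\<ge>n. S t \<or> F t" for n
      unfolding F_def
    proof (rule infinitely_often_not_model_improving[where \<Delta>ub = "Delta_ub P"])
      show "model_improvement X (Delta_ub P) (C l) (f l)" for l
        using fully_lin(1) by (simp add: fully_linear_class_def)
      fix t
      show "x t \<in> X" "\<Delta> t \<in> {0<..Delta_ub P}" using in_X \<Delta> by auto
      assume "\<not> S t" "\<not> fully_linear_all X C f (x t) (\<Delta> t) (m t)"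
        "\<not> fully_linear_all X C f (x (Suc t)) (\<Delta> (Suc t)) (m (Suc t))"
      then have no: "\<not> S t" "\<not> F t" "\<not> F (Suc t)" by (auto simp: F_def)
      \<comment> \<open>Since the routine did not run, the improvement steps started from
        \<open>m t\<close> refer to the retained model and radius.\<close>
      then have eq: "m (Suc t) = m\<^sub>0 (Suc t)" "\<Delta> (Suc t) = \<Delta>\<^sub>0 (Suc t)"
        using after_crit[of "Suc t"] by auto
      have "enat (Suc t) \<le> T" using T less_imp_le by blast
      from improving[OF this no(1,2)] radius_N[OF T no(1,2)] eq
      show "x (Suc t) = x t \<and> \<Delta> (Suc t) = \<Delta> t \<and>
        (\<forall>l. (improve (C l) (x t) (\<Delta> t))\<^sup>+\<^sup>+ (m t l) (m (Suc t) l))" by simp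
    qed (use fully_lin(2) in auto)
    obtain K where K: "0 \<le> K"
      "\<And>y z. y \<in> X \<Longrightarrow> z \<in> X \<Longrightarrow> \<bar>omega X f y - omega X f z\<bar> \<le> K * infnorm (y - z)"
      using omega_lipschitz[of X f] X f_lip by metis
    obtain \<phi>min where \<phi>min: "\<And>y. y \<in> X \<Longrightarrow> \<phi>min \<le> Phi f y"
      using f_bdd by (auto simp: bdd_below_def)
    show ?thesis
    proof (rule trust_region_sequences.w_tendsto_0)
      show "trust_region_sequences x (\<lambda>t. Phi f (x t)) (\<lambda>t. varpi X f (x t)) v \<Delta> \<Delta>\<^sub>0 S F
        (nu_pp P * \<kappa>\<^sub>m) (c * H\<^sub>m) b (eps_crit P) (mu P) (beta P) (gamma_ddown P) (gamma_down P)
        (gamma_up P) K (1 + \<kappa>\<^sub>\<omega>) \<phi>min"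
      proof unfold_locales
        show "0 < nu_pp P * \<kappa>\<^sub>m" "0 < 1 + \<kappa>\<^sub>\<omega>" using P kappa_m kappa_omega(1) by auto
        show "0 < b" using P e(1) cH kappa_m by (simp add: b_def)
        fix t
        show "0 \<le> varpi X f (x t)" using in_X by (rule varpi_nonneg)
        show "varpi X f (x t) \<le> (1 + \<kappa>\<^sub>\<omega>) * v t" by (rule varpi_le)
        show "\<phi>min \<le> Phi f (x t)" using in_X by (rule \<phi>min)
        show "Phi f (x (Suc t)) \<le> Phi f (x t)" by (rule mono)
        show "infnorm (x (Suc t) - x t) \<le> \<Delta> t"
          using next_iterate[OF T, of t] step_in[OF T, of t] \<Delta>(1)[of t]
          by (auto simp: tr_ball_def infnorm_0)
        show "0 < \<Delta> t" "\<Delta> t \<le> \<Delta>\<^sub>0 t" "eps_crit P \<le> v t \<or> \<Delta> t \<le> mu P * v t"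
          "min (beta P * v t) (\<Delta>\<^sub>0 t) \<le> \<Delta> t"
          using after_crit[of t] by auto
        show "nu_pp P * \<kappa>\<^sub>m * v t * min (v t / (c * H\<^sub>m)) (\<Delta> t)
          \<le> Phi f (x t) - Phi f (x (Suc t))" if "S t"
          using that by (rule decrease)
        show "S t" if "F t" "\<Delta> t \<le> b * v t" using that by (rule success)
        show "\<Delta>\<^sub>0 (Suc t) \<in> {\<Delta> t..gamma_up P * \<Delta> t}" if "S t"
          using radius_S[OF T that \<Delta>] by simp
        show "\<Delta>\<^sub>0 (Suc t) \<in> {gamma_ddown P * \<Delta> t..gamma_down P * \<Delta> t}" if "\<not> S t" "F t"
          using T that by (rule radius_F)
        show "\<Delta>\<^sub>0 (Suc t) = \<Delta> t" "x (Suc t) = x t" if "\<not> S t" "\<not> F t"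
          using radius_N[OF T that] by auto
        \<comment> \<open>Taking the minimum with 1 does not increase distances.\<close>
        show "\<bar>varpi X f (x r) - varpi X f (x t)\<bar> \<le> K * infnorm (x r - x t)" for r
          using K(2)[OF in_X[of r] in_X[of t]] by (simp add: varpi_def)
      qed (use P cH K(1) inf_often in auto)
    qed
  qed
qed

end
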